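(* Let $\mathfrak{g}$ be a finite-dimensional centerless Lie algebra (i.e. $Z(\mathfrak{g})=0$) over an algebraically closed field $\mathbb{F}$ of characteristic zero, and let $\sigma\in\mathrm{Aut}(\mathfrak{g})$. If there exists an element $x_0\in\mathfrak{g}$ such that $D(x_0)\neq 0$ for all nonzero $D\in\mathrm{Der}_{\sigma}(\mathfrak{g})$, then $\dim(\mathrm{Der}_{\sigma}(\mathfrak{g}))\leqslant\dim(\mathfrak{g})$.
   Context: $\mathrm{Aut}(\mathfrak{g})$ is the group of Lie algebra automorphisms of $\mathfrak{g}$ and $Z(\mathfrak{g})$ is the center of $\mathfrak{g}$. $\mathrm{Der}_{\sigma}(\mathfrak{g})$ is the vector space of all linear maps $D:\mathfrak{g}\to\mathfrak{g}$ with $D([x,y])=[D(x),\sigma(y)]+[x,D(y)]$ for all $x,y\in\mathfrak{g}$. *)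

theory Defs
  imports
    "HOL-Computational_Algebra.Polynomial"
    "HOL-Library.Function_Algebras"
begin

locale lie_algebra = vector_space scale
  for scale :: "'a::field \<Rightarrow> 'b::ab_group_add \<Rightarrow> 'b" (infixr \<open>*s\<close> 75) +
  fixes bracket :: "'b \<Rightarrow> 'b \<Rightarrow> 'b"
  assumes linear_bracket_right: "Vector_Spaces.linear scale scale (\<lambda>y. bracket x y)"
    and linear_bracket_left: "Vector_Spaces.linear scale scale (\<lambda>x. bracket x y)"
    and bracket_self: "bracket x x = 0"
    and jacobi: "bracket x (bracket y z) + bracket y (bracket z x) + bracket z (bracket x y) = 0"
begin

definition center :: "'b set" where
  "center = {x. \<forall>y. bracket x y = 0}"

definition automorphisms :: "('b \<Rightarrow> 'b) set" where
  "automorphisms =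
     {\<sigma>. Vector_Spaces.linear scale scale \<sigma> \<and> bij \<sigma> \<and> (\<forall>x y. \<sigma> (bracket x y) = bracket (\<sigma> x) (\<sigma> y))}"

definition Der :: "('b \<Rightarrow> 'b) \<Rightarrow> ('b \<Rightarrow> 'b) set" where
  "Der \<sigma> =
     {D. Vector_Spaces.linear scale scale D \<and>
         (\<forall>x y. D (bracket x y) = bracket (D x) (\<sigma> y) + bracket x (D y))}"

end

text \<open>
  Zero and addition of functions are pointwise (Function_Algebras). Together with the scalar
  multiplication below they make \<open>'c \<Rightarrow> 'b\<close> a vector space, in which the set \<open>Der \<sigma>\<close> is a
  subspace. The library's \<open>dim\<close> is \<open>0\<close> on infinite-dimensional sets;
  \<open>finite_dimensional_Der\<close> shows that this case does not occur for \<open>Der \<sigma>\<close> over a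
  finite-dimensional Lie algebra.
\<close>

definition fun_scale :: "('a \<Rightarrow> 'b \<Rightarrow> 'b) \<Rightarrow> 'a \<Rightarrow> ('c \<Rightarrow> 'b) \<Rightarrow> 'c \<Rightarrow> 'b" where
  "fun_scale scale c f = (\<lambda>x. scale c (f x))"

lemma vector_space_fun_scale:
  assumes "vector_space scale"
  shows "vector_space (fun_scale scale)"
proof -
  interpret vector_space scale by fact
  show ?thesis
    by unfold_locales (auto simp: fun_scale_def fun_eq_iff scale_right_distrib scale_left_distrib)
qed

lemma (in lie_algebra) subspace_Der:
  "module.subspace (fun_scale scale) (Der \<sigma>)"
proof -
  interpret F: vector_space "fun_scale scale :: 'a \<Rightarrow> ('b \<Rightarrow> 'b) \<Rightarrow> 'b \<Rightarrow> 'b"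
    by (rule vector_space_fun_scale) unfold_locales
  note br = linear_bracket_right linear_bracket_left
  have add: "bracket (x + y) z = bracket x z + bracket y z"
            "bracket z (x + y) = bracket z x + bracket z y" for x y z
    using br by (simp_all add: Vector_Spaces.linear_iff)
  have sc: "bracket (c *s x) y = c *s bracket x y"
           "bracket x (c *s y) = c *s bracket x y" for c x y
    using br by (simp_all add: Vector_Spaces.linear_iff)
  have z: "bracket 0 y = 0" "bracket x 0 = 0" for x y
    using sc(1)[of 0 x y] sc(2)[of x 0 y] by simp_all
  show ?thesis
    by (rule F.subspaceI)
      (auto simp: Der_def Vector_Spaces.linear_iff fun_scale_def add sc z algebra_simps vector_space_axioms)
qed

lemma (in lie_algebra) finite_dimensional_Der:
  assumes "finite_dimensional_vector_space scale B"
  shows "\<exists>E. finite E \<and> Der \<sigma> \<subseteq> module.span (fun_scale scale) E"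
proof -
  interpret fd: finite_dimensional_vector_space scale B by fact
  interpret F: vector_space "fun_scale scale :: 'a \<Rightarrow> ('b \<Rightarrow> 'b) \<Rightarrow> 'b \<Rightarrow> 'b"
    by (rule vector_space_fun_scale) unfold_locales
  define e where "e b c = (\<lambda>x. representation B x b *s c)" for b c
  define E where "E = (\<lambda>(b, c). e b c) ` (B \<times> B)"
  have rep: "(\<Sum>b\<in>B. representation B x b *s b) = x" for x
    using sum_representation_eq[of B x B] fd.independent_Basis fd.span_Basis fd.finite_Basis
    by simp
  have sum_app: "(\<Sum>i\<in>I. h i) x = (\<Sum>i\<in>I. h i x)" for I :: "'b set" and h :: "'b \<Rightarrow> 'b \<Rightarrow> 'b" and x
    by (induction I rule: infinite_finite_induct) auto
  have "D \<in> F.span E" if "D \<in> Der \<sigma>" for D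
  proof -
    from that interpret D: Vector_Spaces.linear scale scale D by (simp add: Der_def)
    have "D x = (\<Sum>b\<in>B. \<Sum>c\<in>B. fun_scale scale (representation B (D b) c) (e b c)) x" for x
    proof -
      have "D x = D (\<Sum>b\<in>B. representation B x b *s b)" by (simp only: rep)
      also have "\<dots> = (\<Sum>b\<in>B. representation B x b *s D b)" by (simp add: D.sum D.scale)
      also have "\<dots> = (\<Sum>b\<in>B. representation B x b *s (\<Sum>c\<in>B. representation B (D b) c *s c))"
        by (simp only: rep)
      also have "\<dots> = (\<Sum>b\<in>B. \<Sum>c\<in>B. fun_scale scale (representation B (D b) c) (e b c)) x"
        by (simp add: sum_app fun_scale_def e_def scale_sum_right mult.commute)
      finally show ?thesis .
    qed
    then have "D = (\<Sum>b\<in>B. \<Sum>c\<in>B. fun_scale scale (representation B (D b) c) (e b c))"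
      by (rule ext)
    also have "\<dots> \<in> F.span E"
      by (intro F.span_sum F.span_scale F.span_base) (auto simp: E_def)
    finally show ?thesis .
  qed
  moreover have "finite E" using fd.finite_Basis by (simp add: E_def)
  ultimately show ?thesis by blast
qed

end

theory Submission
  imports Defs
begin

text \<open>
  Evaluation at \<open>x\<^sub>0\<close> is a linear map from the space of \<open>\<sigma>\<close>-derivations to the Lie algebra.
  The hypothesis on \<open>x\<^sub>0\<close> says precisely that its kernel is zero, so it embeds
  \<open>Der \<sigma>\<close> into the Lie algebra, and the dimension of \<open>Der \<sigma>\<close> is bounded by that of the
  Lie algebra. The embedding step is \<open>dim_le_of_inj_evaluation\<close>, stated for a subspace of
  vector-valued functions; \<open>subspace_Der\<close> makes it applicable to \<open>Der \<sigma>\<close>.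
\<close>

lemma linear_evaluation:
  assumes "vector_space scale"
  shows "Vector_Spaces.linear (fun_scale scale) scale (\<lambda>f. f x)"
  using assms vector_space_fun_scale[OF assms]
  by (simp add: Vector_Spaces.linear_iff fun_scale_def)

text \<open>
  A basis of \<open>S\<close> stays independent and keeps its cardinality under the injective
  evaluation map, and an independent set in the target has at most \<open>dim UNIV\<close> elements.
\<close>

lemma dim_le_of_inj_evaluation:
  fixes scale :: "'a::field \<Rightarrow> 'b::ab_group_add \<Rightarrow> 'b"
    and S :: "('c \<Rightarrow> 'b) set"
  assumes "finite_dimensional_vector_space scale B"
    and "module.subspace (fun_scale scale) S"
    and nonvanishing: "\<And>f. f \<in> S \<Longrightarrow> f \<noteq> 0 \<Longrightarrow> f x \<noteq> 0"
  shows "vector_space.dim (fun_scale scale) S \<le> vector_space.dim scale (UNIV :: 'b set)"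
proof -
  interpret fd: finite_dimensional_vector_space scale B by fact
  interpret F: vector_space "fun_scale scale :: 'a \<Rightarrow> ('c \<Rightarrow> 'b) \<Rightarrow> 'c \<Rightarrow> 'b"
    by (rule vector_space_fun_scale) unfold_locales
  interpret ev: Vector_Spaces.linear "fun_scale scale" scale "\<lambda>f::'c \<Rightarrow> 'b. f x"
    by (rule linear_evaluation) unfold_locales
  obtain E where E: "E \<subseteq> S" "F.independent E" "S \<subseteq> F.span E" "card E = F.dim S"
    using F.basis_exists by blast
  have span_E: "F.span E = S"
    using E assms(2) by (simp add: F.span_minimal subset_antisym)
  have inj: "inj_on (\<lambda>f. f x) (F.span E)"
    using nonvanishing by (subst ev.inj_on_iff_eq_0[OF F.subspace_span]) (auto simp: span_E)
  have "fd.independent ((\<lambda>f. f x) ` E)"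
    using E(2) inj by (rule ev.independent_injective_image)
  then have "card ((\<lambda>f. f x) ` E) \<le> fd.dim UNIV"
    by (intro fd.independent_card_le_dim) auto
  moreover have "card ((\<lambda>f. f x) ` E) = card E"
    using inj F.span_superset by (intro card_image) (rule inj_on_subset)
  ultimately show ?thesis
    using E(4) by simp
qed

theorem theorem1p5:
  fixes scale :: "'a::{alg_closed_field, field_char_0} \<Rightarrow> 'b::ab_group_add \<Rightarrow> 'b"
    and bracket :: "'b \<Rightarrow> 'b \<Rightarrow> 'b"
    and B :: "'b set"
    and \<sigma> :: "'b \<Rightarrow> 'b"
  assumes "lie_algebra scale bracket"
    and "finite_dimensional_vector_space scale B"
    and "lie_algebra.center bracket = {0}"
    and "\<sigma> \<in> lie_algebra.automorphisms scale bracket"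
    and "\<exists>x\<^sub>0. \<forall>D \<in> lie_algebra.Der scale bracket \<sigma>. D \<noteq> 0 \<longrightarrow> D x\<^sub>0 \<noteq> 0"
  shows "vector_space.dim (fun_scale scale) (lie_algebra.Der scale bracket \<sigma>)
           \<le> vector_space.dim scale (UNIV :: 'b set)"
proof -
  from assms(5) obtain x where
    "\<And>D. D \<in> lie_algebra.Der scale bracket \<sigma> \<Longrightarrow> D \<noteq> 0 \<Longrightarrow> D x \<noteq> 0"
    by blast
  with assms(2) lie_algebra.subspace_Der[OF assms(1)] show ?thesis
    by (rule dim_le_of_inj_evaluation)
qed

end
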